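(* Let $d\ge 2$ and $1\le k\le d$. Let $\alpha_{k,d}$ be the infimum of those $\alpha\in\mathbb{R}$ for which $\mathcal{L}^{\binom{k+1}{2}}(T_k(E))>0$ holds for every compact set $E\subset\mathbb{R}^d$ with Hausdorff dimension $\dim_{\mathcal H}(E)>\alpha$. Then $$\alpha_{k,d}\ge\max\left\{k-1,\frac{d}{2}\right\}.$$ Moreover, $\alpha_{2,2}\ge\frac{3}{2}$.
   Context: $\mathcal{L}^m$ is $m$-dimensional Lebesgue measure. Points $x^1,\dots,x^{k+1}\in\mathbb{R}^d$ are called nondegenerate (affinely independent) if $x^2-x^1,\dots,x^{k+1}-x^1$ are linearly independent. $T_k(E)$ denotes the set of congruence classes of nondegenerate $(k+1)$-tuples of points of $E$, where $(x^1,\dots,x^{k+1})\sim(y^1,\dots,y^{k+1})$ iff both are nondegenerate and $|x^i-x^j|=|y^i-y^j|$ for all $1\le i<j\le k+1$; it is identified with the subset $\{(|x^i-x^j|)_{1\le i<j\le k+1}: x^1,\dots,x^{k+1}\in E\text{ nondegenerate}\}$ of $\mathbb{R}^{\binom{k+1}{2}}$. *)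

theory Defs
  imports "HOL-Analysis.Analysis"
begin

section \<open>Hausdorff dimension\<close>

text \<open>
  Boundedness of the covering sets is required because \<^const>\<open>diameter\<close> is only meaningful for
  bounded sets. The empty set has diameter 0, so finite covers are included.
  Since \<open>0 powr 0 = 0\<close>, the value at \<open>s = 0\<close> is not the counting measure; the dimension below
  uses only \<open>s > 0\<close>, which does not change the infimum.
\<close>

definition hausdorff_premeasure :: "real \<Rightarrow> real \<Rightarrow> 'a::metric_space set \<Rightarrow> ennreal" where
  "hausdorff_premeasure \<delta> s E =
     Inf {(\<Sum>i. ennreal (diameter (U i) powr s)) | U :: nat \<Rightarrow> 'a set.
            E \<subseteq> (\<Union>i. U i) \<and> (\<forall>i. bounded (U i) \<and> diameter (U i) \<le> \<delta>)}"

definition hausdorff_measure :: "real \<Rightarrow> 'a::metric_space set \<Rightarrow> ennreal" where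
  "hausdorff_measure s E = (SUP \<delta>\<in>{0<..}. hausdorff_premeasure \<delta> s E)"

definition hausdorff_dim :: "'a::metric_space set \<Rightarrow> ereal" where
  "hausdorff_dim E = Inf {ereal s | s. s > 0 \<and> hausdorff_measure s E = 0}"


section \<open>Congruence classes of nondegenerate tuples\<close>

text \<open>
  A \<open>(k+1)\<close>-tuple is a function on \<^typ>\<open>nat\<close> of which only the values at \<open>1, \<dots>, k+1\<close> matter.
  Injectivity is needed because linear independence is asserted of the family of differences,
  whereas \<^const>\<open>independent\<close> speaks about the set of its values.
\<close>

definition nondegenerate :: "nat \<Rightarrow> (nat \<Rightarrow> 'a::real_vector) \<Rightarrow> bool" where
  "nondegenerate k x \<longleftrightarrow>
     inj_on (\<lambda>i. x i - x 1) {2..k+1} \<and> independent ((\<lambda>i. x i - x 1) ` {2..k+1})"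

definition index_pairs :: "nat \<Rightarrow> (nat \<times> nat) set" where
  "index_pairs k = {(i, j). 1 \<le> i \<and> i < j \<and> j \<le> k + 1}"

text \<open>
  A congruence class is identified with its vector of pairwise distances, a point of
  \<open>\<real>\<close> to the power \<open>(k+1) choose 2\<close>, realised as the extensional functions on \<open>index_pairs k\<close>.
\<close>

definition congruence_classes ::
    "nat \<Rightarrow> 'a::real_normed_vector set \<Rightarrow> (nat \<times> nat \<Rightarrow> real) set" where
  "congruence_classes k E =
     {(\<lambda>(i, j)\<in>index_pairs k. norm (x i - x j)) | x.
        (\<forall>i\<in>{1..k+1}. x i \<in> E) \<and> nondegenerate k x}"

text \<open>
  Lebesgue measure is the completion of the product Borel measure, as in the definition of
  \<^const>\<open>lebesgue\<close>. For compact \<open>E\<close> the set \<open>congruence_classes k E\<close> is \<open>\<sigma>\<close>-compact, so the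
  convention that non-measurable sets get measure 0 plays no role.
\<close>

definition lebesgue_pairs :: "nat \<Rightarrow> (nat \<times> nat \<Rightarrow> real) measure" where
  "lebesgue_pairs k = completion (Pi\<^sub>M (index_pairs k) (\<lambda>_. lborel))"


section \<open>The dimensional threshold\<close>

text \<open>
  The type \<open>'n\<close> indexes the coordinates, so \<open>d = CARD('n)\<close>. The set is nonempty (every
  \<open>\<alpha> \<ge> d\<close> belongs to it) and, for \<open>k \<ge> 1\<close>, bounded below by 0 (singletons have dimension 0),
  so the real infimum is the genuine one.
\<close>

definition threshold :: "nat \<Rightarrow> 'n::finite itself \<Rightarrow> real" where
  "threshold k _ =
     Inf {\<alpha>::real. \<forall>E :: (real ^ 'n) set. compact E \<and> hausdorff_dim E > ereal \<alpha> \<longrightarrow>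
            emeasure (lebesgue_pairs k) (congruence_classes k E) > 0}"

end

theory Submission
  imports Defs
begin

text \<open>
  If every point of \<open>E \<subseteq> [0, 1]\<^sup>d\<close> is \<open>\<delta>\<close>-close to the lattice of mesh \<open>1 / q\<close>, then the distance
  vectors of \<open>E\<close> lie in boxes of side \<open>O(\<delta>)\<close> around those of lattice simplices. A box has volume
  \<open>O(\<delta>\<^sup>m)\<close> with \<open>m = (k + 1) choose 2\<close>. There are \<open>O(q\<^sup>2\<^sup>m)\<close> boxes, since each distance takes
  \<open>O(q\<^sup>2)\<close> values, and for \<open>d = k = 2\<close> there are only \<open>O(q\<^sup>4)\<close>, since a triangle may be translated
  to have a vertex at the origin. So the congruence classes form a null set if \<open>q\<^sup>\<mu> \<delta> \<rightarrow> 0\<close> along a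
  sequence of meshes, where \<open>\<mu> = 2\<close> and \<open>\<mu> = 4/3\<close> respectively.

  Such \<open>E = K\<^sup>d\<close> exists with dimension arbitrarily close to \<open>d / \<mu>\<close>: the points of \<open>K\<close> are
  \<open>\<Sum>\<^sub>j a\<^sub>j / Q\<^sub>j\<close> with digits \<open>a\<^sub>j < N\<close> and denominators \<open>Q\<^sub>j\<close> that divide each other, grow at least
  by the factor \<open>2 N\<close> and at rare places jump. Reading \<open>a\<^sub>j\<close> as base-\<open>N\<close> digits maps \<open>K\<close> onto the unit
  interval, and the Hoelder exponent of this map bounds the dimension from below.

  The bound \<open>k - 1\<close> holds because a cube of dimension \<open>k - 1\<close> contains no nondegenerate
  \<open>k\<close>-simplex.
\<close>

section \<open>Hausdorff dimension\<close>

lemma compact_vec_box: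
  fixes K :: "'n::finite \<Rightarrow> real set"
  assumes "\<And>i. compact (K i)"
  shows "compact {x :: real ^ 'n. \<forall>i. x $ i \<in> K i}"
proof -
  have "closed {x :: real ^ 'n. x $ i \<in> K i}" for i
    using closed_vimage[of "K i" "\<lambda>x :: real ^ 'n. x $ i", OF compact_imp_closed[OF assms]]
    by (simp add: vimage_def continuous_on_component)
  then have "closed {x :: real ^ 'n. \<forall>i. x $ i \<in> K i}"
    by (rule closed_Collect_all)
  moreover have "\<exists>B. \<forall>i. \<forall>x\<in>K i. \<bar>x\<bar> \<le> B"
  proof -
    have "bounded (\<Union>i. K i)"
      using assms compact_imp_bounded by (intro bounded_UN) auto
    then show ?thesis
      unfolding bounded_iff real_norm_def by blast
  qed
  then obtain B where B: "\<And>i x. x \<in> K i \<Longrightarrow> \<bar>x\<bar> \<le> B" by blast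
  have "bounded {x :: real ^ 'n. \<forall>i. x $ i \<in> K i}"
  proof (rule boundedI)
    fix x :: "real ^ 'n" assume "x \<in> {x. \<forall>i. x $ i \<in> K i}"
    then have "(\<Sum>i\<in>UNIV. \<bar>x $ i\<bar>) \<le> (\<Sum>i\<in>(UNIV :: 'n set). B)"
      using B by (intro sum_mono) auto
    with norm_le_l1_cart[of x] show "norm x \<le> (\<Sum>i\<in>(UNIV :: 'n set). B)"
      by linarith
  qed
  ultimately show ?thesis
    by (simp add: compact_eq_bounded_closed)
qed

lemma hausdorff_measure_eq_0I:
  fixes E :: "'a::metric_space set"
  assumes "\<And>\<delta> \<epsilon>. 0 < \<delta> \<Longrightarrow> 0 < \<epsilon> \<Longrightarrow> \<exists>A. finite A \<and> E \<subseteq> \<Union>A \<and>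
             (\<forall>U\<in>A. bounded U \<and> diameter U \<le> \<delta>) \<and> (\<Sum>U\<in>A. diameter U powr s) \<le> \<epsilon>"
  shows "hausdorff_measure s E = 0"
proof -
  have "hausdorff_premeasure \<delta> s E \<le> 0" if "0 < \<delta>" for \<delta>
  proof (rule ennreal_le_epsilon)
    fix \<epsilon> :: real assume "0 < \<epsilon>"
    then obtain A where A: "finite A" "E \<subseteq> \<Union>A" "\<And>U. U \<in> A \<Longrightarrow> bounded U \<and> diameter U \<le> \<delta>"
      and sum: "(\<Sum>U\<in>A. diameter U powr s) \<le> \<epsilon>"
      using assms[OF \<open>0 < \<delta>\<close> \<open>0 < \<epsilon>\<close>] by blast
    obtain h where h: "bij_betw h {0..<card A} A"
      using ex_bij_betw_nat_finite[OF A(1)] by blast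
    \<comment> \<open>A finite cover is padded by the empty set: its diameter is 0 and
      \<open>0 powr s = 0\<close>, so the padding adds nothing to the sum.\<close>
    define U where "U i = (if i < card A then h i else {})" for i
    have "E \<subseteq> (\<Union>i. U i)"
    proof
      fix x assume "x \<in> E"
      with A(2) obtain V where "V \<in> A" "x \<in> V" by blast
      moreover from \<open>V \<in> A\<close> have "V \<in> h ` {0..<card A}"
        using h by (simp add: bij_betw_def)
      then obtain i where "i < card A" "h i = V" by auto
      ultimately show "x \<in> (\<Union>i. U i)"
        by (auto simp: U_def intro!: exI[of _ i])
    qed
    moreover have "h i \<in> A" if "i < card A" for i
      using that h by (auto simp: bij_betw_def)
    then have "\<forall>i. bounded (U i) \<and> diameter (U i) \<le> \<delta>"
      using A(3) \<open>0 < \<delta>\<close> by (auto simp: U_def)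
    ultimately have "hausdorff_premeasure \<delta> s E \<le> (\<Sum>i. ennreal (diameter (U i) powr s))"
      unfolding hausdorff_premeasure_def by (intro Inf_lower) auto
    also have "\<dots> = (\<Sum>i<card A. ennreal (diameter (U i) powr s))"
      by (intro suminf_finite) (auto simp: U_def)
    also have "\<dots> = (\<Sum>i<card A. ennreal (diameter (h i) powr s))"
      by (simp add: U_def)
    also have "\<dots> = (\<Sum>V\<in>A. ennreal (diameter V powr s))"
      using sum.reindex_bij_betw[OF h, of "\<lambda>V. ennreal (diameter V powr s)"]
      by (simp add: atLeast0LessThan)
    also have "\<dots> = ennreal (\<Sum>V\<in>A. diameter V powr s)"
      by (intro sum_ennreal) simp
    finally show "hausdorff_premeasure \<delta> s E \<le> 0 + ennreal \<epsilon>"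
      using ennreal_leI[OF sum] by simp
  qed
  then show ?thesis
    unfolding hausdorff_measure_def by (metis SUP_least bot.extremum_uniqueI bot_ennreal greaterThan_iff)
qed

lemma hausdorff_measure_eq_0D:
  assumes "hausdorff_measure s E = 0" "0 < \<delta>" "0 < \<epsilon>"
  shows "\<exists>U. E \<subseteq> (\<Union>i. U i) \<and> (\<forall>i. bounded (U i) \<and> diameter (U i) \<le> \<delta>) \<and>
    (\<Sum>i::nat. ennreal (diameter (U i) powr s)) < ennreal \<epsilon>"
proof -
  have "hausdorff_premeasure \<delta> s E \<le> hausdorff_measure s E"
    unfolding hausdorff_measure_def using assms(2) by (intro SUP_upper) auto
  then have "hausdorff_premeasure \<delta> s E < ennreal \<epsilon>"
    using assms by simp
  then show ?thesis
    unfolding hausdorff_premeasure_def Inf_less_iff by blast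
qed

section \<open>Lower dimension bounds from maps with a Hoelder inverse\<close>

text \<open>A cover of \<open>E\<close> by sets \<open>U i\<close> pulls back along \<open>p\<close>
  to a cover of the unit cube. By the Hoelder bound the preimage of \<open>U i\<close> lies in a box
  of side \<open>2 * C * diameter (U i) powr t\<close>. If \<open>s\<close> were less than
  \<open>card M * t\<close>, the volumes of these boxes would be controlled by the sum of
  \<open>diameter (U i) powr s\<close>, which can be made too small to cover a cube of volume
  1.\<close>

lemma hausdorff_dim_ge:
  fixes E :: "'a::metric_space set" and p :: "('i \<Rightarrow> real) \<Rightarrow> 'a"
  assumes M: "finite M" and t: "0 < t" and C: "0 < C"
    and pE: "\<And>y. y \<in> M \<rightarrow>\<^sub>E {0..<1} \<Longrightarrow> p y \<in> E"
    and holder: "\<And>y z i. y \<in> M \<rightarrow>\<^sub>E {0..<1} \<Longrightarrow> z \<in> M \<rightarrow>\<^sub>E {0..<1} \<Longrightarrow> i \<in> M \<Longrightarrow>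
                   \<bar>y i - z i\<bar> \<le> C * dist (p y) (p z) powr t"
  shows "ereal (real (card M) * t) \<le> hausdorff_dim E"
  unfolding hausdorff_dim_def
proof (rule Inf_greatest, clarsimp)
  fix s :: real assume s: "0 < s" and null: "hausdorff_measure s E = 0"
  interpret product_sigma_finite "\<lambda>_. lborel :: real measure"
    by standard
  let ?P = "Pi\<^sub>M M (\<lambda>_. lborel :: real measure)"
  show "real (card M) * t \<le> s"
  proof (rule ccontr)
    assume "\<not> real (card M) * t \<le> s"
    then have less: "s < real (card M) * t" by simp
    define m where "m = card M"
    define c where "c = (2 * C) ^ m"
    have c: "0 < c" using C by (simp add: c_def)
    \<comment> \<open>The bound \<open>1 / c\<close> on the sum makes the total volume of the boxes
      less than 1. Diameters of at most 1 are requested because the passage from exponent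
      \<open>m * t\<close> down to \<open>s\<close> increases powers only for such bases.\<close>
    have "0 < 1 / c" using c by simp
    from hausdorff_measure_eq_0D[OF null zero_less_one this]
    obtain U where cover: "E \<subseteq> (\<Union>i. U i)" and bdd: "\<And>i. bounded (U i)"
      and diam: "\<And>i. diameter (U i) \<le> 1"
      and small: "(\<Sum>i::nat. ennreal (diameter (U i) powr s)) < ennreal (1 / c)"
      by blast
    have "\<exists>B \<in> sets ?P. {y \<in> M \<rightarrow>\<^sub>E {0..<1}. p y \<in> U i} \<subseteq> B \<and>
            emeasure ?P B \<le> ennreal (c * diameter (U i) powr s)" for i
    proof (cases "\<exists>z \<in> M \<rightarrow>\<^sub>E {0..<1}. p z \<in> U i")
      case True
      then obtain z where z: "z \<in> M \<rightarrow>\<^sub>E {0..<1}" "p z \<in> U i" by blast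
      define r where "r = diameter (U i) powr t"
      define B where "B = (\<Pi>\<^sub>E j\<in>M. {z j - C * r..z j + C * r})"
      have "{y \<in> M \<rightarrow>\<^sub>E {0..<1}. p y \<in> U i} \<subseteq> B"
      proof clarify
        fix y assume y: "y \<in> M \<rightarrow>\<^sub>E {0..<1}" "p y \<in> U i"
        have "\<bar>y j - z j\<bar> \<le> C * r" if "j \<in> M" for j
        proof -
          have "\<bar>y j - z j\<bar> \<le> C * dist (p y) (p z) powr t"
            using holder y z that by blast
          also have "dist (p y) (p z) \<le> diameter (U i)"
            using bdd y z by (intro diameter_bounded_bound) auto
          then have "C * dist (p y) (p z) powr t \<le> C * r"
            unfolding r_def using C t by (intro mult_left_mono powr_mono2) auto
          finally show ?thesis .
        qed
        then show "y \<in> B"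
          using y by (fastforce simp: B_def PiE_iff abs_le_iff)
      qed
      moreover have "B \<in> sets ?P"
        unfolding B_def using M by (intro sets_PiM_I_finite) auto
      moreover have "emeasure ?P B \<le> ennreal (c * diameter (U i) powr s)"
      proof -
        have "0 \<le> C * r" using C by (simp add: r_def)
        have "emeasure ?P B = (\<Prod>j\<in>M. ennreal (2 * C * r))"
          unfolding B_def using M \<open>0 \<le> C * r\<close> by (subst emeasure_PiM) (auto simp: mult.assoc)
        also have "\<dots> = ennreal (c * r ^ m)"
          using \<open>0 \<le> C * r\<close> by (simp add: ennreal_power c_def m_def power_mult_distrib)
        also have "\<dots> \<le> ennreal (c * diameter (U i) powr s)"
        proof (intro ennreal_leI mult_left_mono)
          \<comment> \<open>For diameter 0 both sides vanish provided that \<open>m > 0\<close>,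
            which follows from \<open>0 < s < m * t\<close>.\<close>
          have "r ^ m = diameter (U i) powr (m * t)"
          proof (cases "diameter (U i) = 0")
            case True
            then show ?thesis using less s by (cases m) (auto simp: r_def m_def)
          next
            case False
            then have "diameter (U i) > 0"
              using diameter_ge_0[OF bdd[of i]] by simp
            then show ?thesis
              by (simp add: r_def powr_powr mult.commute flip: powr_realpow)
          qed
          also have "\<dots> \<le> diameter (U i) powr s"
            using less diam diameter_ge_0[OF bdd[of i]] s
            by (intro powr_mono') (auto simp: m_def)
          finally show "r ^ m \<le> diameter (U i) powr s" .
        qed (use c in simp)
        finally show ?thesis .
      qed
      ultimately show ?thesis by blast
    next
      case False
      then show ?thesis by (intro bexI[of _ "{}"]) auto
    qed
    then have "\<forall>i. \<exists>B. B \<in> sets ?P \<and> {y \<in> M \<rightarrow>\<^sub>E {0..<1}. p y \<in> U i} \<subseteq> B \<and>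
            emeasure ?P B \<le> ennreal (c * diameter (U i) powr s)"
      by blast
    from choice[OF this] obtain B where B: "\<And>i. B i \<in> sets ?P" "\<And>i. {y \<in> M \<rightarrow>\<^sub>E {0..<1}. p y \<in> U i} \<subseteq> B i"
      "\<And>i. emeasure ?P (B i) \<le> ennreal (c * diameter (U i) powr s)"
      by blast
    have "1 = emeasure ?P (M \<rightarrow>\<^sub>E {0..<1})"
      using M by (subst emeasure_PiM) auto
    also have "\<dots> \<le> emeasure ?P (\<Union>i. B i)"
    proof (rule emeasure_mono)
      show "M \<rightarrow>\<^sub>E {0..<1} \<subseteq> (\<Union>i. B i)"
      proof
        fix y :: "'i \<Rightarrow> real" assume y: "y \<in> M \<rightarrow>\<^sub>E {0..<1}"
        then obtain i where "p y \<in> U i" using pE cover by blast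
        with y show "y \<in> (\<Union>i. B i)" using B(2)[of i] by blast
      qed
      show "(\<Union>i. B i) \<in> sets ?P"
        using B(1) by (intro sets.countable_UN) auto
    qed
    also have "\<dots> \<le> (\<Sum>i. emeasure ?P (B i))"
      using B(1) by (intro emeasure_subadditive_countably) auto
    also have "\<dots> \<le> (\<Sum>i. ennreal c * ennreal (diameter (U i) powr s))"
      using B(3) c by (intro suminf_le) (auto simp: ennreal_mult)
    also have "\<dots> = ennreal c * (\<Sum>i. ennreal (diameter (U i) powr s))"
      by simp
    also have "\<dots> < ennreal c * ennreal (1 / c)"
      using small c by (intro ennreal_mult_strict_left_mono) auto
    also have "\<dots> = 1"
      using c by (simp flip: ennreal_mult)
    finally show False by simp
  qed
qed

section \<open>Bounded sets have finite dimension\<close>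

lemma diameter_vec_le:
  fixes S :: "(real ^ 'n) set"
  assumes "\<And>x y i. x \<in> S \<Longrightarrow> y \<in> S \<Longrightarrow> \<bar>x $ i - y $ i\<bar> \<le> r" "0 \<le> r"
  shows "bounded S \<and> diameter S \<le> real CARD('n) * r"
proof -
  have le: "dist x y \<le> real CARD('n) * r" if "x \<in> S" "y \<in> S" for x y
  proof -
    have "norm (x - y) \<le> (\<Sum>i\<in>UNIV. \<bar>(x - y) $ i\<bar>)"
      by (rule norm_le_l1_cart)
    also have "\<dots> \<le> (\<Sum>i\<in>(UNIV::'n set). r)"
      using assms(1)[OF that] by (intro sum_mono) auto
    finally show ?thesis by (simp add: dist_norm)
  qed
  have "bounded S"
    using le unfolding bounded_any_center bounded_def
    by blast
  moreover have "diameter S \<le> real CARD('n) * r"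
    using le assms(2) by (intro diameter_le) (auto simp: dist_norm)
  ultimately show ?thesis by blast
qed

text \<open>A grid of mesh \<open>1 / N\<close> has \<open>O(N ^ d)\<close> cells that meet
  \<open>E\<close>, each of diameter at most \<open>d / N\<close>, so the sums with exponent
  \<open>d + 1\<close> are \<open>O(1 / N)\<close>. This crude bound serves to show that the infimum
  in \<open>threshold\<close> is taken over a nonempty set.\<close>

lemma hausdorff_dim_le_bounded:
  fixes E :: "(real ^ 'n) set"
  assumes "bounded E"
  shows "hausdorff_dim E \<le> ereal (real CARD('n) + 1)"
proof -
  define d where "d = real CARD('n)"
  have d: "1 \<le> d" unfolding d_def by (simp add: Suc_leI)
  obtain B where "0 < B" and B: "\<And>x. x \<in> E \<Longrightarrow> norm x \<le> B"
    using assms bounded_pos by blast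
  obtain b where b: "B \<le> real b" using real_arch_simple by blast
  have "hausdorff_measure (d + 1) E = 0"
  proof (rule hausdorff_measure_eq_0I)
    fix \<delta> \<epsilon> :: real assume "0 < \<delta>" "0 < \<epsilon>"
    \<comment> \<open>The count \<open>((2 * b + 1) * N) ^ d\<close> of the cells times
      \<open>(d / N) powr (d + 1)\<close> is \<open>c / N\<close>.\<close>
    define c where "c = (real (2 * b + 1)) ^ CARD('n) * d powr (d + 1)"
    have c: "0 < c" using d by (simp add: c_def)
    obtain N where "d / \<delta> < real N" "c / \<epsilon> < real N" "0 < N"
    proof -
      obtain N where "max (d / \<delta>) (c / \<epsilon>) < real N" using reals_Archimedean2 by blast
      moreover have "0 < d / \<delta>" using d \<open>0 < \<delta>\<close> by simp
      ultimately have "0 < real N" by (simp only: max_less_iff_conj) linarith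
      then have "0 < N" by simp
      moreover note \<open>max (d / \<delta>) (c / \<epsilon>) < real N\<close>
      ultimately show ?thesis using that by auto
    qed
    then have N: "d / N \<le> \<delta>" "c / N \<le> \<epsilon>"
      using \<open>0 < \<delta>\<close> \<open>0 < \<epsilon>\<close> by (auto simp: field_simps)
    define cell where "cell z = {x \<in> E. \<forall>i. \<lfloor>N * x $ i\<rfloor> = z i}" for z :: "'n \<Rightarrow> int"
    define Z where "Z = (UNIV :: 'n set) \<rightarrow>\<^sub>E {- int (N * b)..int (N * b)}"
    have "finite Z" unfolding Z_def by (intro finite_PiE) auto
    have cardZ: "real (card Z) \<le> (real (2 * b + 1) * N) ^ CARD('n)"
    proof -
      have "card Z = (2 * (N * b) + 1) ^ CARD('n)"
        proof -
        have "nat (int (N * b) - (- int (N * b)) + 1) = 2 * (N * b) + 1" by linarith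
        then show ?thesis unfolding Z_def by (simp add: card_PiE)
      qed
      also have "real \<dots> \<le> (real (2 * b + 1) * N) ^ CARD('n)"
        unfolding of_nat_power using \<open>0 < N\<close> by (intro power_mono) (auto simp: algebra_simps)
      finally show ?thesis by simp
    qed
    have cell: "bounded (cell z) \<and> diameter (cell z) \<le> d / N" for z
    proof -
      have "\<bar>x $ i - y $ i\<bar> \<le> 1 / N" if "x \<in> cell z" "y \<in> cell z" for x y i
      proof -
        have "\<lfloor>N * x $ i\<rfloor> = \<lfloor>N * y $ i\<rfloor>" using that by (simp add: cell_def)
        then have "\<bar>N * x $ i - N * y $ i\<bar> \<le> 1" by linarith
        then have "N * \<bar>x $ i - y $ i\<bar> \<le> 1" by (simp add: abs_mult flip: right_diff_distrib)
        then show ?thesis using \<open>0 < N\<close> by (simp add: field_simps)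
      qed
      from diameter_vec_le[OF this] show ?thesis by (simp add: d_def)
    qed
    have "E \<subseteq> \<Union>(cell ` Z)"
    proof
      fix x assume "x \<in> E"
      define z where "z i = \<lfloor>N * x $ i\<rfloor>" for i
      have "z i \<in> {- int (N * b)..int (N * b)}" for i
      proof -
        have "\<bar>x $ i\<bar> \<le> b"
          using component_le_norm_cart[of x i] B[OF \<open>x \<in> E\<close>] b by linarith
        then have "\<bar>N * x $ i\<bar> \<le> real (N * b)"
          by (simp add: abs_mult mult_left_mono)
        then show ?thesis unfolding z_def
          by (auto simp: le_floor_iff floor_le_iff simp del: of_nat_mult)
      qed
      then have "z \<in> Z" unfolding Z_def by (intro PiE_I) auto
      then show "x \<in> \<Union>(cell ` Z)" using \<open>x \<in> E\<close> by (auto simp: cell_def z_def intro!: bexI[of _ z])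
    qed
    moreover have "(\<Sum>U\<in>cell ` Z. diameter U powr (d + 1)) \<le> \<epsilon>"
    proof -
      have "(\<Sum>U\<in>cell ` Z. diameter U powr (d + 1)) \<le> (\<Sum>U\<in>cell ` Z. (d / N) powr (d + 1))"
        using cell diameter_ge_0 d by (intro sum_mono powr_mono2) auto
      also have "\<dots> \<le> card Z * (d / N) powr (d + 1)"
        using card_image_le[OF \<open>finite Z\<close>, of cell] by (simp add: mult_right_mono)
      also have "\<dots> \<le> (real (2 * b + 1) * N) ^ CARD('n) * (d / N) powr (d + 1)"
        using cardZ by (intro mult_right_mono) auto
      also have "\<dots> = c / N"
        using \<open>0 < N\<close> d by (simp add: c_def power_mult_distrib powr_divide powr_add powr_realpow d_def)
      finally show ?thesis using N by linarith
    qed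
    ultimately show "\<exists>A. finite A \<and> E \<subseteq> \<Union>A \<and> (\<forall>U\<in>A. bounded U \<and> diameter U \<le> \<delta>) \<and>
        (\<Sum>U\<in>A. diameter U powr (d + 1)) \<le> \<epsilon>"
      using cell N \<open>finite Z\<close> by (intro exI[of _ "cell ` Z"]) (auto intro: order_trans)
  qed
  then show ?thesis
    unfolding hausdorff_dim_def by (intro Inf_lower) (auto simp: d_def)
qed


section \<open>Cantor sets close to lattices\<close>

text \<open>Whenever the growth bound leaves enough room, the denominator jumps almost up to
  \<open>R ^ n\<close>; elsewhere it grows by the factor \<open>D\<close> only.\<close>

fun denom :: "nat \<Rightarrow> real \<Rightarrow> real \<Rightarrow> nat \<Rightarrow> nat" where
  "denom D R \<mu> 0 = 1"
| "denom D R \<mu> (Suc n) = D * denom D R \<mu> n *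
     (if real (denom D R \<mu> n) powr \<mu> \<le> R ^ Suc n
      then nat \<lfloor>R ^ Suc n / (D * denom D R \<mu> n)\<rfloor> else 1)"

section \<open>Growth, divisibility and jumps of the denominators\<close>

context
  fixes D :: nat and R \<mu> :: real
  assumes D: "1 < D" and \<mu>: "1 \<le> \<mu>" and DR: "real D powr \<mu> < R"
begin

private abbreviation "Q \<equiv> denom D R \<mu>"

lemma R_ge: "real D \<le> R"
proof -
  have "real D powr 1 \<le> real D powr \<mu>" using D \<mu> by (intro powr_mono) auto
  then show ?thesis using DR by simp
qed

text \<open>Both claims need a joint induction: at a jump the new denominator is positive only if
  the floor is at least 1, and this comes from the growth bound at the preceding index together with
  \<open>D \<le> R\<close>.\<close>

lemma denom_pos_le: "0 < Q n \<and> real (Q n) \<le> R ^ n"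
proof (induction n)
  case 0
  then show ?case by simp
next
  case (Suc n)
  define a where "a = real D * Q n"
  have a: "0 < a" using Suc D by (simp add: a_def)
  have aR: "a \<le> R ^ Suc n"
    unfolding a_def power_Suc using Suc R_ge by (intro mult_mono) auto
  have "1 \<le> \<lfloor>R ^ Suc n / a\<rfloor>"
    using aR a by (simp add: le_floor_iff)
  moreover have "a * of_int \<lfloor>R ^ Suc n / a\<rfloor> \<le> R ^ Suc n"
    using a by (metis mult.commute of_int_floor_le pos_le_divide_eq)
  then have "a * real (nat \<lfloor>R ^ Suc n / a\<rfloor>) \<le> R ^ Suc n"
    using \<open>1 \<le> \<lfloor>R ^ Suc n / a\<rfloor>\<close> by simp
  ultimately show ?case using Suc D aR by (auto simp: a_def)
qed

lemma denom_pos: "0 < Q n" and denom_le: "real (Q n) \<le> R ^ n"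
  using denom_pos_le by auto

lemma denom_Suc_ge: "D * Q n \<le> Q (Suc n)"
  using denom_pos[of n] denom_pos[of "Suc n"] D by (auto split: if_splits)

lemma denom_dvd: "m \<le> n \<Longrightarrow> Q m dvd Q n"
  by (induction rule: dec_induct) (auto intro: dvd_mult dvd_mult2)

lemma denom_ge_power: "D ^ i * Q n \<le> Q (n + i)"
proof (induction i)
  case (Suc i)
  have "D ^ Suc i * Q n \<le> D * Q (n + i)" using Suc by (simp add: mult.assoc)
  also have "\<dots> \<le> Q (n + Suc i)" using denom_Suc_ge[of "n + i"] by simp
  finally show ?case .
qed simp

text \<open>Without jumps from \<open>m\<close> on, the denominators would be
  \<open>D ^ i * Q m\<close>, and their \<mu>-th powers would grow by the factor
  \<open>D powr \<mu>\<close> only. As this is less than \<open>R\<close>, they would fall below the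
  powers of \<open>R\<close>, which is exactly the condition for a jump.\<close>

lemma denom_jump: "\<exists>n\<ge>m. real (Q n) powr \<mu> \<le> 2 * Q (Suc n)"
proof -
  have "\<exists>n\<ge>m. real (Q n) powr \<mu> \<le> R ^ Suc n"
  proof (rule ccontr)
    assume "\<not> ?thesis"
    then have no: "real (Q n) powr \<mu> > R ^ Suc n" if "m \<le> n" for n
      using that by force
    have Q: "Q (m + i) = D ^ i * Q m" for i
    proof (induction i)
      case (Suc i)
      show ?case using no[of "m + i"] Suc by simp
    qed simp
    define x where "x = R / real D powr \<mu>"
    have x: "1 < x" using DR D by (simp add: x_def)
    obtain i where i: "real (Q m) powr \<mu> < x ^ i"
      using real_arch_pow[OF x] by blast
    have "R ^ Suc (m + i) < real (Q (m + i)) powr \<mu>" using no by simp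
    also have "\<dots> = (real D powr \<mu>) ^ i * real (Q m) powr \<mu>"
      using D by (simp add: Q powr_mult powr_powr mult.commute flip: powr_realpow)
    also have "\<dots> < (real D powr \<mu>) ^ i * x ^ i"
      using i D by (intro mult_strict_left_mono) auto
    also have "\<dots> = R ^ i" using D by (simp add: x_def power_divide)
    also have "\<dots> \<le> R ^ Suc (m + i)"
      using R_ge D by (intro power_increasing) auto
    finally show False by simp
  qed
  then obtain n where n: "m \<le> n" "real (Q n) powr \<mu> \<le> R ^ Suc n" by blast
  define a where "a = real D * Q n"
  have a: "0 < a" using denom_pos D by (simp add: a_def)
  have "a \<le> R ^ Suc n"
    unfolding a_def power_Suc using denom_le[of n] R_ge by (intro mult_mono) auto
  then have "1 \<le> R ^ Suc n / a" using a by simp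
  then have "1 \<le> \<lfloor>R ^ Suc n / a\<rfloor>" by (simp add: le_floor_iff)
  \<comment> \<open>A real number that is at least 1 is at most twice its floor; this is the factor
    2 of the claim.\<close>
  then have "R ^ Suc n / a \<le> 2 * of_int \<lfloor>R ^ Suc n / a\<rfloor>" "0 \<le> \<lfloor>R ^ Suc n / a\<rfloor>" by linarith+
  then have "R ^ Suc n \<le> 2 * (a * of_int \<lfloor>R ^ Suc n / a\<rfloor>)"
    using a by (simp add: field_simps)
  also have "\<dots> = 2 * Q (Suc n)"
    using n(2) \<open>0 \<le> \<lfloor>R ^ Suc n / a\<rfloor>\<close> by (simp add: a_def)
  finally show ?thesis using n by (intro exI[of _ n]) auto
qed

end

section \<open>Digits in base \<open>N\<close>\<close>

text \<open>On the unit interval, index 0 is the first digit after the point. As a difference of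
  consecutive truncations, a digit is determined by the two floors, so digits are compared by
  comparing truncations.\<close>

definition digit :: "nat \<Rightarrow> nat \<Rightarrow> real \<Rightarrow> int" where
  "digit N j y = \<lfloor>real N ^ Suc j * y\<rfloor> - int N * \<lfloor>real N ^ j * y\<rfloor>"

lemma digit_bounds:
  assumes "0 < N"
  shows "0 \<le> digit N j y" "digit N j y \<le> int N - 1"
proof -
  define w where "w = real N ^ j * y"
  have eq: "real N ^ Suc j * y = real N * w" by (simp add: w_def)
  have "real N * of_int \<lfloor>w\<rfloor> \<le> real N * w" by (intro mult_left_mono) auto
  then have "of_int (int N * \<lfloor>w\<rfloor>) \<le> real N * w" by simp
  then show "0 \<le> digit N j y"
    unfolding digit_def eq w_def[symmetric] by (simp add: le_floor_iff)
  have "real N * w < real N * (of_int \<lfloor>w\<rfloor> + 1)"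
    using assms by (intro mult_strict_left_mono) linarith+
  then have "real N * w < of_int (int N * \<lfloor>w\<rfloor> + int N)" by (simp add: algebra_simps)
  then have "\<lfloor>real N * w\<rfloor> < int N * \<lfloor>w\<rfloor> + int N" by (simp only: floor_less_iff)
  then show "digit N j y \<le> int N - 1"
    unfolding digit_def eq w_def[symmetric] by simp
qed

text \<open>Consider the least \<open>n\<close> at which the truncations of \<open>N ^ n * y\<close>
  and \<open>N ^ n * y'\<close> differ. It is not 0, since both floors vanish there, so
  \<open>n = Suc m\<close>. Equality up to \<open>m\<close> gives equal earlier digits and the
  distance bound; inequality at \<open>Suc m\<close> gives distinct digits at
  \<open>m\<close>.\<close>

lemma first_distinct_digit:
  assumes N: "2 \<le> N" and y: "y \<in> {0..<1}" "y' \<in> {0..<1}" and ne: "y \<noteq> y'"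
  obtains m where "\<And>j. j < m \<Longrightarrow> digit N j y = digit N j y'" "digit N m y \<noteq> digit N m y'"
    "\<bar>y - y'\<bar> \<le> 1 / real N ^ m"
proof -
  define P where "P n \<longleftrightarrow> \<lfloor>real N ^ n * y\<rfloor> \<noteq> \<lfloor>real N ^ n * y'\<rfloor>" for n
  have "\<exists>n. P n"
  proof -
    obtain n where "1 / \<bar>y - y'\<bar> < real N ^ n"
      using real_arch_pow[of "real N"] N by auto
    then have "1 < real N ^ n * \<bar>y - y'\<bar>" using ne by (simp add: field_simps)
    then have "1 < \<bar>real N ^ n * y - real N ^ n * y'\<bar>"
      by (simp add: abs_mult flip: right_diff_distrib)
    then show ?thesis unfolding P_def by (intro exI[of _ n]) linarith
  qed
  define n where "n = (LEAST n. P n)"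
  have n: "P n" and least: "\<And>j. j < n \<Longrightarrow> \<not> P j"
    using LeastI_ex[OF \<open>\<exists>n. P n\<close>] not_less_Least unfolding n_def by auto
  have "\<lfloor>y\<rfloor> = 0" "\<lfloor>y'\<rfloor> = 0" using y by (auto simp: floor_eq_iff)
  then have "\<not> P 0" by (simp add: P_def)
  then obtain m where m: "n = Suc m" using n by (cases n) auto
  show thesis
  proof
    show "digit N j y = digit N j y'" if "j < m" for j
      using least[of j] least[of "Suc j"] that m by (simp add: digit_def P_def)
    show "digit N m y \<noteq> digit N m y'"
      using least[of m] n m by (simp add: digit_def P_def)
    have "\<lfloor>real N ^ m * y\<rfloor> = \<lfloor>real N ^ m * y'\<rfloor>" using least[of m] m by (simp add: P_def)
    then have "\<bar>real N ^ m * y - real N ^ m * y'\<bar> \<le> 1" by linarith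
    then have "real N ^ m * \<bar>y - y'\<bar> \<le> 1" by (simp add: abs_mult flip: right_diff_distrib)
    then show "\<bar>y - y'\<bar> \<le> 1 / real N ^ m" using N by (simp add: field_simps)
  qed
qed

section \<open>Construction of the Cantor set\<close>

text \<open>The denominators are built with \<open>D = 2 * N\<close> and
  \<open>R = N powr (1 / t)\<close>. Their growth bound \<open>R ^ n\<close> yields the Hoelder
  exponent \<open>t\<close>, and their jumps yield the approximation by lattices. The condition
  \<open>t * \<mu>\<^sub>0 < 1\<close> is what makes room for both when \<open>N\<close> is
  large.\<close>

lemma cantor_set_near_lattices:
  fixes t \<mu>\<^sub>0 :: real
  assumes t: "0 < t" and \<mu>\<^sub>0: "1 \<le> \<mu>\<^sub>0" "t * \<mu>\<^sub>0 < 1"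
  obtains K :: "real set" and \<phi> C where
    "compact K" "K \<subseteq> {0..1}" "0 < C" "\<And>y. y \<in> {0..<1} \<Longrightarrow> \<phi> y \<in> K"
    "\<And>y z. y \<in> {0..<1} \<Longrightarrow> z \<in> {0..<1} \<Longrightarrow> \<bar>y - z\<bar> \<le> C * \<bar>\<phi> y - \<phi> z\<bar> powr t"
    "\<And>\<epsilon>. 0 < \<epsilon> \<Longrightarrow> \<exists>q::nat. \<exists>\<delta>>0. 0 < q \<and> real q powr \<mu>\<^sub>0 * \<delta> \<le> \<epsilon> \<and>
       (\<forall>x\<in>K. \<exists>z::int. \<bar>x - z / q\<bar> \<le> \<delta>)"
proof -
  \<comment> \<open>The jumps alone keep \<open>Q n powr \<mu> * \<delta>\<close> bounded; the
    surplus \<open>\<mu> - \<mu>\<^sub>0\<close> later makes the product with exponent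
    \<open>\<mu>\<^sub>0\<close> arbitrarily small.\<close>
  obtain \<mu> where \<mu>: "\<mu>\<^sub>0 < \<mu>" "\<mu> < 1 / t"
    using dense[of \<mu>\<^sub>0 "1 / t"] \<mu>\<^sub>0 t by (auto simp: field_simps)
  obtain N :: nat where N: "2 \<le> N" and N\<mu>: "real (2 * N) powr \<mu> < real N powr (1 / t)"
  proof -
    \<comment> \<open>The required inequality amounts to
      \<open>2 powr \<mu> < N powr (1 / t - \<mu>)\<close>, which holds for every
      \<open>N > b\<close>.\<close>
    define b where "b = (2 powr \<mu>) powr (1 / (1 / t - \<mu>))"
    obtain N :: nat where N: "max 2 b < real N" using reals_Archimedean2 by blast
    have "2 powr \<mu> = b powr (1 / t - \<mu>)" using \<mu> by (simp add: b_def powr_powr)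
    also have "\<dots> < real N powr (1 / t - \<mu>)"
      using \<mu> N by (intro powr_less_mono2) (auto simp: b_def)
    finally have "2 powr \<mu> * real N powr \<mu> < real N powr (1 / t - \<mu>) * real N powr \<mu>"
      using N by (intro mult_strict_right_mono) auto
    then have "real (2 * N) powr \<mu> < real N powr (1 / t)"
      by (simp add: powr_mult flip: powr_add)
    with N that[of N] show thesis by auto
  qed
  define R where "R = real N powr (1 / t)"
  define Q where "Q = denom (2 * N) R \<mu>"
  have *: "1 < 2 * N" "1 \<le> \<mu>" "real (2 * N) powr \<mu> < R"
    using N N\<mu> \<mu> \<mu>\<^sub>0 by (auto simp: R_def)
  note Q_pos = denom_pos[OF *, folded Q_def] and Q_le = denom_le[OF *, folded Q_def]
    and Q_Suc = denom_Suc_ge[OF *, folded Q_def] and Q_dvd = denom_dvd[OF *, folded Q_def]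
    and Q_power = denom_ge_power[OF *, folded Q_def] and Q_jump = denom_jump[OF *, folded Q_def]
  have term_le: "1 / real (Q (n + i)) \<le> (1 / Q n) * (1 / real (2 * N)) ^ i" for n i
  proof -
    have "real (2 * N) ^ i * Q n \<le> Q (n + i)"
      using Q_power[where n=n and i=i] by (metis of_nat_le_iff of_nat_mult of_nat_power)
    moreover have "0 < real (2 * N) ^ i * Q n" using N Q_pos by simp
    ultimately have "1 / real (Q (n + i)) \<le> 1 / (real (2 * N) ^ i * Q n)"
      by (intro divide_left_mono mult_pos_pos) (use N Q_pos in auto)
    then show ?thesis by (simp add: power_one_over field_simps)
  qed
  \<comment> \<open>The coefficients \<open>c\<close> may be digits or differences of digits.
    Comparison with a geometric series of ratio \<open>1 / (2 * N)\<close> gives the factor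
    \<open>(N - 1) * 2 * N / (2 * N - 1)\<close>, which is at most \<open>N\<close>.\<close>
  have tail: "summable (\<lambda>i. real_of_int (c i) / Q (n + i)) \<and>
      \<bar>\<Sum>i. real_of_int (c i) / Q (n + i)\<bar> \<le> N / Q n"
    if c: "\<And>i. \<bar>c i\<bar> \<le> int N - 1" for c :: "nat \<Rightarrow> int" and n
  proof -
    define g where "g i = real (N - 1) / Q n * (1 / real (2 * N)) ^ i" for i
    have bound: "norm (real_of_int (c i) / Q (n + i)) \<le> g i" for i
    proof -
      have "norm (real_of_int (c i) / Q (n + i)) = \<bar>c i\<bar> * (1 / Q (n + i))" by simp
      also have "\<dots> \<le> real (N - 1) * ((1 / Q n) * (1 / real (2 * N)) ^ i)"
        using c[of i] N by (intro mult_mono term_le) (auto simp: of_nat_diff)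
      finally show ?thesis by (simp add: g_def)
    qed
    have "(\<lambda>i. (1 / real (2 * N)) ^ i) sums (1 / (1 - 1 / real (2 * N)))"
      using N by (intro geometric_sums) auto
    then have "g sums (real (N - 1) / Q n * (1 / (1 - 1 / real (2 * N))))"
      unfolding g_def by (rule sums_mult)
    then have g: "summable g" "suminf g = real (N - 1) / Q n * (1 / (1 - 1 / real (2 * N)))"
      by (auto simp: sums_iff)
    have "real (N - 1) * (1 / (1 - 1 / real (2 * N))) \<le> N"
      using N by (simp add: field_simps of_nat_diff)
    then have "real (N - 1) * (1 / (1 - 1 / real (2 * N))) / Q n \<le> N / Q n"
      by (rule divide_right_mono) simp
    then have "suminf g \<le> N / Q n" using g(2) by (simp only: times_divide_eq_left)
    moreover have "norm (\<Sum>i. real_of_int (c i) / Q (n + i)) \<le> suminf g"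
      using bound g(1) by (rule norm_suminf_le)
    ultimately show ?thesis
      using summable_comparison_test'[OF g(1), of 0 "\<lambda>i. real_of_int (c i) / Q (n + i)"] bound by auto
  qed
  have dig: "\<bar>digit N j y\<bar> \<le> int N - 1" "\<bar>digit N j y - digit N j z\<bar> \<le> int N - 1" for j y z
    using digit_bounds[of N j y] digit_bounds[of N j z] N by auto
  define \<phi> where "\<phi> y = (\<Sum>j. real_of_int (digit N j y) / Q (1 + j))" for y
  have split: "\<phi> y = (\<Sum>j<n. real_of_int (digit N j y) / Q (1 + j)) +
      (\<Sum>i. real_of_int (digit N (i + n) y) / Q (Suc n + i))" for y n
  proof -
    have "summable (\<lambda>j. real_of_int (digit N j y) / Q (1 + j))" using tail[of "\<lambda>j. digit N j y" 1] dig by blast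
    from suminf_split_initial_segment[OF this, of n] show ?thesis
      by (simp add: \<phi>_def add.commute)
  qed
  have range: "\<phi> y \<in> {0..1}" for y
  proof -
    have "0 \<le> \<phi> y" unfolding \<phi>_def
      using tail[of "\<lambda>j. digit N j y" 1] dig digit_bounds(1)[of N] N
      by (intro suminf_nonneg) auto
    moreover have "\<phi> y \<le> N / Q 1"
      unfolding \<phi>_def using tail[of "\<lambda>j. digit N j y" 1] dig by auto
    moreover have "N \<le> Q 1" using Q_Suc[of 0] Q_pos[of 0] by (simp add: Q_def)
    then have "real N / Q 1 \<le> 1" using Q_pos[of 1] by simp
    ultimately show ?thesis by simp
  qed
  have holder: "\<bar>y - z\<bar> \<le> N * 2 powr t * \<bar>\<phi> y - \<phi> z\<bar> powr t"
    if yz: "y \<in> {0..<1}" "z \<in> {0..<1}" for y z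
  proof (cases "y = z")
    case True
    then show ?thesis by simp
  next
    case False
    obtain m where m: "\<And>j. j < m \<Longrightarrow> digit N j y = digit N j z" "digit N m y \<noteq> digit N m z"
      "\<bar>y - z\<bar> \<le> 1 / real N ^ m"
      using first_distinct_digit[OF N yz False] by blast
    define c where "c i = digit N (i + Suc m) y - digit N (i + Suc m) z" for i
    have "\<phi> y - \<phi> z = real_of_int (digit N m y - digit N m z) / Q (Suc m) +
        (\<Sum>i. real_of_int (c i) / Q (Suc (Suc m) + i))"
    proof -
      have "(\<Sum>i. real_of_int (c i) / Q (Suc (Suc m) + i)) =
          (\<Sum>i. real_of_int (digit N (i + Suc m) y) / Q (Suc (Suc m) + i)) -
          (\<Sum>i. real_of_int (digit N (i + Suc m) z) / Q (Suc (Suc m) + i))"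
        unfolding c_def of_int_diff diff_divide_distrib
        using tail[of "\<lambda>i. digit N (i + Suc m) _" "Suc (Suc m)"] dig
        by (intro suminf_diff[symmetric]) blast+
      then show ?thesis
        using m(1) by (simp add: split[where n = "Suc m"] diff_divide_distrib)
    qed
    \<comment> \<open>Since the denominators grow at least by the factor \<open>2 * N\<close>,
      everything after the first distinct digit cancels at most half of the contribution of that
      digit.\<close>
    moreover have "\<bar>\<Sum>i. real_of_int (c i) / Q (Suc (Suc m) + i)\<bar> \<le> 1 / (2 * Q (Suc m))"
    proof -
      have "\<bar>\<Sum>i. real_of_int (c i) / Q (Suc (Suc m) + i)\<bar> \<le> N / Q (Suc (Suc m))"
        using tail[of c "Suc (Suc m)"] dig(2) unfolding c_def by blast
      also have "\<dots> \<le> N / real (2 * N * Q (Suc m))"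
        using Q_Suc[of "Suc m"] Q_pos N
        by (intro divide_left_mono) (auto simp del: of_nat_mult)
      finally show ?thesis using N by simp
    qed
    moreover have "1 / Q (Suc m) \<le> \<bar>real_of_int (digit N m y - digit N m z) / Q (Suc m)\<bar>"
    proof -
      have "1 \<le> \<bar>digit N m y - digit N m z\<bar>" using m(2) by simp
      then have "1 \<le> \<bar>real_of_int (digit N m y - digit N m z)\<bar>" by linarith
      then show ?thesis by (simp add: abs_divide divide_right_mono)
    qed
    ultimately have gap: "1 / (2 * Q (Suc m)) \<le> \<bar>\<phi> y - \<phi> z\<bar>"
      by (simp add: field_simps)
    \<comment> \<open>By the choice of \<open>R\<close> one has \<open>R powr t = N\<close>. The
      index of the denominator is one ahead of the exponent of \<open>N\<close>, which costs the
      factor \<open>N\<close> in the Hoelder constant; the lost half of the gap costs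
      \<open>2 powr t\<close>.\<close>
    have "real (Q (Suc m)) powr t \<le> (R ^ Suc m) powr t"
      using Q_le[of "Suc m"] t by (intro powr_mono2) auto
    also have "\<dots> = real N ^ Suc m"
      using N t by (simp add: R_def powr_powr powr_realpow[symmetric] powr_mult powr_add del: powr_realpow)
    finally have "1 / real N ^ m \<le> N * (1 / real (Q (Suc m)) powr t)"
      using N Q_pos[of "Suc m"] by (simp add: field_simps)
    also have "\<dots> = N * 2 powr t * (1 / (2 * Q (Suc m))) powr t"
      by (simp add: powr_divide powr_mult)
    also have "\<dots> \<le> N * 2 powr t * \<bar>\<phi> y - \<phi> z\<bar> powr t"
      using gap t by (intro mult_left_mono powr_mono2) auto
    finally show ?thesis using m(3) by linarith
  qed
  \<comment> \<open>The first \<open>n\<close> terms have denominators dividing \<open>Q n\<close>,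
    so their sum is a multiple of \<open>1 / Q n\<close>; the tail bound controls the rest.\<close>
  have near: "\<exists>z::int. \<bar>\<phi> y - z / Q n\<bar> \<le> N / Q (Suc n)" for y n
  proof -
    have "\<exists>z::int. (\<Sum>j<n. real_of_int (digit N j y) / Q (1 + j)) = z / Q n"
    proof (intro exI)
      have "real_of_int (digit N j y) / Q (1 + j) =
          real_of_int (digit N j y * int (Q n div Q (1 + j))) / Q n" if "j < n" for j
        using Q_dvd[of "1 + j" n] that Q_pos[of n] Q_pos[of "1 + j"]
        by (simp add: real_of_nat_div field_simps)
      then show "(\<Sum>j<n. real_of_int (digit N j y) / Q (1 + j)) =
          of_int (\<Sum>j<n. digit N j y * int (Q n div Q (1 + j))) / Q n"
        by (simp add: sum_divide_distrib)
    qed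
    then show ?thesis
    proof
      fix z :: int
      assume "(\<Sum>j<n. real_of_int (digit N j y) / Q (1 + j)) = z / Q n"
      then have "\<phi> y - z / Q n = (\<Sum>i. real_of_int (digit N (i + n) y) / Q (Suc n + i))"
        using split[of y n] by simp
      then show ?thesis
        using tail[of "\<lambda>i. digit N (i + n) y" "Suc n", OF dig(1)] by (intro exI[of _ z]) simp
    qed
  qed
  \<comment> \<open>The closure provides compactness, since the image of \<open>\<phi>\<close> need
    not be closed.\<close>
  define K where "K = closure (\<phi> ` {0..<1})"
  have "K \<subseteq> {0..1}"
    unfolding K_def using range by (intro closure_minimal) auto
  then have "compact K"
    using bounded_subset[OF bounded_closed_interval, of K 0 1]
    by (simp add: K_def compact_eq_bounded_closed)
  moreover note \<open>K \<subseteq> {0..1}\<close>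
  moreover have "0 < real N * 2 powr t" using N by simp
  moreover have "\<phi> y \<in> K" if "y \<in> {0..<1}" for y
    unfolding K_def using that by (intro subsetD[OF closure_subset]) auto
  moreover note holder
  moreover have "\<exists>q::nat. \<exists>\<delta>>0. 0 < q \<and> real q powr \<mu>\<^sub>0 * \<delta> \<le> \<epsilon> \<and>
       (\<forall>x\<in>K. \<exists>z::int. \<bar>x - z / q\<bar> \<le> \<delta>)" if "0 < \<epsilon>" for \<epsilon>
  proof -
    \<comment> \<open>Chosen so that
      \<open>A powr (\<mu> - \<mu>\<^sub>0) = 4 * N / \<epsilon>\<close>. A jump past index
      \<open>m\<close> has \<open>Q n \<ge> (2 * N) ^ n \<ge> 2 ^ m > A\<close>.\<close>
    define A where "A = (4 * N / \<epsilon>) powr (1 / (\<mu> - \<mu>\<^sub>0))"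
    obtain m where "A < 2 ^ m" using real_arch_pow[of 2 A] by auto
    obtain n where n: "m \<le> n" "real (Q n) powr \<mu> \<le> 2 * Q (Suc n)" using Q_jump by blast
    have "(2::real) ^ m \<le> real (2 * N) ^ n"
    proof -
      have "(2::real) ^ m \<le> 2 ^ n" using n(1) by simp
      also have "\<dots> \<le> real (2 * N) ^ n" using N by (intro power_mono) auto
      finally show ?thesis .
    qed
    moreover have "real (2 * N) ^ n \<le> real (Q n)"
      using Q_power[where n = 0 and i = n] unfolding of_nat_power[symmetric] of_nat_le_iff
      by (simp add: Q_def)
    ultimately have "A < Q n" using \<open>A < 2 ^ m\<close> by linarith
    then have "A powr (\<mu> - \<mu>\<^sub>0) \<le> real (Q n) powr (\<mu> - \<mu>\<^sub>0)"
      using \<mu> by (intro powr_mono2) (auto simp: A_def)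
    moreover have "A powr (\<mu> - \<mu>\<^sub>0) = 4 * N / \<epsilon>"
      using \<mu> N \<open>0 < \<epsilon>\<close> by (simp add: A_def powr_powr)
    ultimately have big: "4 * N / \<epsilon> \<le> real (Q n) powr (\<mu> - \<mu>\<^sub>0)" by simp
    \<comment> \<open>Twice the bound for points of the image: one half is spent on approximating a
      point of the closure by a point of the image.\<close>
    define \<delta> where "\<delta> = 2 * N / Q (Suc n)"
    have "0 < \<delta>" using N Q_pos by (simp add: \<delta>_def)
    have "4 * N * real (Q n) powr \<mu>\<^sub>0 \<le> \<epsilon> * (real (Q n) powr (\<mu> - \<mu>\<^sub>0) * real (Q n) powr \<mu>\<^sub>0)"
      using mult_right_mono[OF big, of "\<epsilon> * real (Q n) powr \<mu>\<^sub>0"] \<open>0 < \<epsilon>\<close>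
      by (simp add: algebra_simps)
    also have "\<dots> \<le> \<epsilon> * (2 * Q (Suc n))"
      using n(2) \<open>0 < \<epsilon>\<close> by (simp flip: powr_add)
    finally have "real (Q n) powr \<mu>\<^sub>0 * \<delta> \<le> \<epsilon>"
      using Q_pos[of "Suc n"] by (simp add: \<delta>_def field_simps)
    moreover have "\<exists>z::int. \<bar>x - z / Q n\<bar> \<le> \<delta>" if "x \<in> K" for x
    proof -
      have "0 < \<delta> / 2" using \<open>0 < \<delta>\<close> by simp
      with that obtain y where "dist (\<phi> y) x < \<delta> / 2"
        unfolding K_def closure_approachable by blast
      moreover obtain z :: int where "\<bar>\<phi> y - z / Q n\<bar> \<le> \<delta> / 2"
        using near[of y n] by (auto simp: \<delta>_def)
      ultimately have "\<bar>x - z / Q n\<bar> \<le> \<delta>"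
        unfolding dist_real_def by linarith
      then show ?thesis ..
    qed
    ultimately show ?thesis
      using \<open>0 < \<delta>\<close> Q_pos by (intro exI[of _ "Q n"] exI[of _ \<delta>]) auto
  qed
  ultimately show thesis by (rule that)
qed


section \<open>Simplices close to lattices\<close>

lemma finite_index_pairs: "finite (index_pairs k)"
  by (rule finite_subset[of _ "{..k+1} \<times> {..k+1}"]) (auto simp: index_pairs_def)

lemma emeasure_lebesgue_pairs_le:
  assumes "T \<subseteq> B" "B \<in> sets (Pi\<^sub>M (index_pairs k) (\<lambda>_. lborel))"
  shows "emeasure (lebesgue_pairs k) T \<le> emeasure (Pi\<^sub>M (index_pairs k) (\<lambda>_. lborel)) B"
proof -
  have "emeasure (lebesgue_pairs k) T \<le> emeasure (lebesgue_pairs k) B"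
    using assms by (intro emeasure_mono) (auto simp: lebesgue_pairs_def)
  then show ?thesis using assms(2) by (simp add: lebesgue_pairs_def emeasure_completion)
qed

lemma abs_norm_diff_le:
  fixes x y u v :: "real ^ 'n"
  assumes "\<And>i. \<bar>x $ i - u $ i\<bar> \<le> \<delta>" "\<And>i. \<bar>y $ i - v $ i\<bar> \<le> \<delta>"
  shows "\<bar>norm (x - y) - norm (u - v)\<bar> \<le> 2 * real CARD('n) * \<delta>"
proof -
  have le: "norm (a - b) \<le> real CARD('n) * \<delta>" if "\<And>i. \<bar>a $ i - b $ i\<bar> \<le> \<delta>" for a b :: "real ^ 'n"
  proof -
    have "(\<Sum>i\<in>UNIV. \<bar>(a - b) $ i\<bar>) \<le> (\<Sum>i\<in>(UNIV :: 'n set). \<delta>)"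
      using that by (intro sum_mono) auto
    with norm_le_l1_cart[of "a - b"] show ?thesis by simp
  qed
  have "\<bar>norm (x - y) - norm (u - v)\<bar> \<le> norm ((x - y) - (u - v))"
    by (rule norm_triangle_ineq3)
  also have "\<dots> = norm ((x - u) - (y - v))" by (simp add: algebra_simps)
  also have "\<dots> \<le> norm (x - u) + norm (y - v)" by (rule norm_triangle_ineq4)
  also have "\<dots> \<le> 2 * real CARD('n) * \<delta>" using le[of x u] le[of y v] assms by simp
  finally show ?thesis .
qed

text \<open>Replacing points by their approximations \<open>h x\<close> changes each distance by at
  most \<open>2 * d * \<delta>\<close>. Hence every distance vector lies in a box of side
  \<open>4 * d * \<delta>\<close> centred at an element of \<open>F\<close>, and the volumes add
  up.\<close>

lemma emeasure_congruence_classes_le: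
  fixes E :: "(real ^ 'n) set"
  assumes \<delta>: "0 \<le> \<delta>" and near: "\<And>x i. x \<in> E \<Longrightarrow> \<bar>x $ i - h x $ i\<bar> \<le> \<delta>" and F: "finite F"
    and hF: "\<And>x. \<forall>i\<in>{1..k+1}. x i \<in> E \<Longrightarrow> (\<lambda>(i, j)\<in>index_pairs k. norm (h (x i) - h (x j))) \<in> F"
  shows "emeasure (lebesgue_pairs k) (congruence_classes k E) \<le>
           ennreal (real (card F) * (4 * real CARD('n) * \<delta>) ^ card (index_pairs k))"
proof -
  interpret product_sigma_finite "\<lambda>_. lborel :: real measure"
    by standard
  let ?P = "Pi\<^sub>M (index_pairs k) (\<lambda>_. lborel :: real measure)"
  define r where "r = 2 * real CARD('n) * \<delta>"
  have r: "0 \<le> r" using \<delta> by (simp add: r_def)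
  define B where "B c = (\<Pi>\<^sub>E p\<in>index_pairs k. {c p - r..c p + r})" for c
  have B: "B c \<in> sets ?P" for c
    unfolding B_def using finite_index_pairs by (intro sets_PiM_I_finite) auto
  have emB: "emeasure ?P (B c) = ennreal ((2 * r) ^ card (index_pairs k))" for c
    unfolding B_def using r finite_index_pairs by (subst emeasure_PiM) (auto simp: ennreal_power)
  have "congruence_classes k E \<subseteq> (\<Union>c\<in>F. B c)"
    unfolding congruence_classes_def
  proof clarify
    fix x assume x: "\<forall>i\<in>{1..k+1}. x i \<in> E"
    define c where "c = (\<lambda>(i, j)\<in>index_pairs k. norm (h (x i) - h (x j)))"
    have "(\<lambda>(i, j)\<in>index_pairs k. norm (x i - x j)) \<in> B c"
      unfolding B_def
    proof (intro PiE_I)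
      fix p assume p: "p \<in> index_pairs k"
      obtain i j where ij: "p = (i, j)" by fastforce
      have "i \<in> {1..k+1}" "j \<in> {1..k+1}" using p by (auto simp: ij index_pairs_def)
      then have "\<bar>norm (x i - x j) - norm (h (x i) - h (x j))\<bar> \<le> r"
        unfolding r_def using x near by (intro abs_norm_diff_le) auto
      then show "(\<lambda>(i, j)\<in>index_pairs k. norm (x i - x j)) p \<in> {c p - r..c p + r}"
        using p by (auto simp: c_def ij)
    qed auto
    then show "(\<lambda>(i, j)\<in>index_pairs k. norm (x i - x j)) \<in> (\<Union>c\<in>F. B c)"
      using hF[OF x] unfolding c_def by blast
  qed
  then have "emeasure (lebesgue_pairs k) (congruence_classes k E) \<le> emeasure ?P (\<Union>c\<in>F. B c)"
    using B F by (intro emeasure_lebesgue_pairs_le) auto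
  also have "\<dots> \<le> (\<Sum>c\<in>F. emeasure ?P (B c))"
    using B F by (intro emeasure_subadditive_finite) auto
  also have "\<dots> = ennreal (real (card F) * (2 * r) ^ card (index_pairs k))"
    using r by (simp add: emB ennreal_mult ennreal_of_nat_eq_real_of_nat)
  also have "2 * r = 4 * real CARD('n) * \<delta>" by (simp add: r_def)
  finally show ?thesis .
qed

definition lattice_point :: "nat \<Rightarrow> ('n \<Rightarrow> int) \<Rightarrow> real ^ 'n" where
  "lattice_point q z = (\<chi> l. real_of_int (z l) / real q)"

text \<open>The range \<open>2 * q\<close> leaves room for lattice points near, but outside, the unit cube.\<close>

definition lattice_classes :: "nat \<Rightarrow> 'n::finite itself \<Rightarrow> nat \<Rightarrow> (nat \<times> nat \<Rightarrow> real) set" where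
  "lattice_classes k _ q =
     {(\<lambda>(i, j)\<in>index_pairs k. norm (lattice_point q (z i) - lattice_point q (z j))) |
        z :: nat \<Rightarrow> 'n \<Rightarrow> int. \<forall>i\<in>{1..k+1}. \<forall>l. \<bar>z i l\<bar> \<le> 2 * int q}"

text \<open>Rounding each coordinate to the lattice gives a cover of total volume at most
  \<open>c * (q powr \<mu> * \<delta>) ^ m\<close>, and \<open>near\<close> makes the base of this
  power as small as desired.\<close>

lemma emeasure_congruence_classes_near_lattices_eq_0:
  fixes K :: "real set"
  assumes k: "1 \<le> k" and A: "0 \<le> A" and K: "K \<subseteq> {0..1}"
    and near: "\<And>\<epsilon>. 0 < \<epsilon> \<Longrightarrow> \<exists>q::nat. \<exists>\<delta>>0. 0 < q \<and> real q powr \<mu> * \<delta> \<le> \<epsilon> \<and>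
       (\<forall>x\<in>K. \<exists>z::int. \<bar>x - z / q\<bar> \<le> \<delta>)"
    and \<mu>: "0 \<le> \<mu>"
    and count: "\<And>q. 0 < q \<Longrightarrow> finite (lattice_classes k TYPE('n::finite) q) \<and>
       real (card (lattice_classes k TYPE('n) q)) \<le> A * (real q powr \<mu>) ^ card (index_pairs k)"
  shows "emeasure (lebesgue_pairs k) (congruence_classes k {x :: real ^ 'n. \<forall>i. x $ i \<in> K}) = 0"
proof -
  define m where "m = card (index_pairs k)"
  have "(1, 2) \<in> index_pairs k" using k by (simp add: index_pairs_def)
  then have "0 < m" using finite_index_pairs[of k] unfolding m_def card_gt_0_iff by blast
  then have m: "1 \<le> m" by simp
  define c where "c = A * (4 * real CARD('n)) ^ m"
  have c: "0 \<le> c" using A by (simp add: c_def)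
  define E where "E = {x :: real ^ 'n. \<forall>i. x $ i \<in> K}"
  have "emeasure (lebesgue_pairs k) (congruence_classes k E) \<le> 0"
  proof (rule ennreal_le_epsilon)
    fix \<epsilon> :: real assume "0 < \<epsilon>"
    \<comment> \<open>The bound 1 gives \<open>\<eta> ^ m \<le> \<eta>\<close> and
      \<open>\<delta> \<le> 1\<close>; the denominator is \<open>c + 1\<close> because
      \<open>c\<close> may be 0.\<close>
    define \<eta> where "\<eta> = min 1 (\<epsilon> / (c + 1))"
    have \<eta>: "0 < \<eta>" "\<eta> \<le> 1" "c * \<eta> \<le> \<epsilon>"
    proof -
      show "0 < \<eta>" "\<eta> \<le> 1" using \<open>0 < \<epsilon>\<close> c by (auto simp: \<eta>_def)
      have "c * \<eta> \<le> (c + 1) * (\<epsilon> / (c + 1))"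
        using c \<open>0 < \<epsilon>\<close> \<open>0 < \<eta>\<close> by (intro mult_mono) (auto simp: \<eta>_def)
      then show "c * \<eta> \<le> \<epsilon>" using c by simp
    qed
    obtain q :: nat and \<delta> where q: "0 < q" "0 < \<delta>" "real q powr \<mu> * \<delta> \<le> \<eta>"
      and "\<forall>x\<in>K. \<exists>z::int. \<bar>x - z / q\<bar> \<le> \<delta>"
      using near[OF \<eta>(1)] by blast
    then obtain z :: "real \<Rightarrow> int" where z: "\<And>x. x \<in> K \<Longrightarrow> \<bar>x - z x / q\<bar> \<le> \<delta>"
      by metis
    have "\<delta> \<le> 1"
    proof -
      have "1 * \<delta> \<le> real q powr \<mu> * \<delta>"
        using q \<mu> by (intro mult_right_mono ge_one_powr_ge_zero) auto
      then show ?thesis using q(3) \<eta>(2) by linarith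
    qed
    \<comment> \<open>From \<open>x\<close> in the unit interval and \<open>\<delta> \<le> 1\<close>
      it follows that \<open>z x / q\<close> lies between -1 and 2.\<close>
    have zq: "\<bar>z x\<bar> \<le> 2 * int q" if "x \<in> K" for x
    proof -
      have "\<bar>z x / real q\<bar> \<le> 2" using z[OF that] K that \<open>\<delta> \<le> 1\<close> by fastforce
      then have "real_of_int \<bar>z x\<bar> \<le> real_of_int (2 * int q)" using q(1) by (simp add: field_simps)
      then show ?thesis by (simp only: of_int_le_iff)
    qed
    have "emeasure (lebesgue_pairs k) (congruence_classes k E) \<le>
        ennreal (real (card (lattice_classes k TYPE('n) q)) * (4 * real CARD('n) * \<delta>) ^ card (index_pairs k))"
    proof (rule emeasure_congruence_classes_le)
      show "\<bar>x $ i - lattice_point q (\<lambda>l. z (x $ l)) $ i\<bar> \<le> \<delta>" if "x \<in> E" for x i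
        using that z by (simp add: E_def lattice_point_def)
      show "(\<lambda>(i, j)\<in>index_pairs k. norm (lattice_point q (\<lambda>l. z (x i $ l)) -
          lattice_point q (\<lambda>l. z (x j $ l)))) \<in> lattice_classes k TYPE('n) q"
        if "\<forall>i\<in>{1..k+1}. x i \<in> E" for x
        using that zq unfolding lattice_classes_def E_def
        by (intro CollectI exI[of _ "\<lambda>i l. z (x i $ l)"]) auto
    qed (use q count in auto)
    also have "\<dots> \<le> ennreal \<epsilon>"
    proof (rule ennreal_leI)
      have "real (card (lattice_classes k TYPE('n) q)) * (4 * real CARD('n) * \<delta>) ^ m \<le>
          A * (real q powr \<mu>) ^ m * (4 * real CARD('n) * \<delta>) ^ m"
        using count[OF q(1)] q(2) by (intro mult_right_mono) (auto simp: m_def)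
      also have "\<dots> = c * (real q powr \<mu> * \<delta>) ^ m"
        by (simp add: c_def power_mult_distrib)
      also have "\<dots> \<le> c * \<eta> ^ m"
        using c q by (intro mult_left_mono power_mono) auto
      also have "\<dots> \<le> c * \<eta>"
        using c \<eta> m power_decreasing[of 1 m \<eta>] by (intro mult_left_mono) auto
      finally show "real (card (lattice_classes k TYPE('n) q)) *
          (4 * real CARD('n) * \<delta>) ^ card (index_pairs k) \<le> \<epsilon>"
        using \<eta>(3) by (simp add: m_def)
    qed
    finally show "emeasure (lebesgue_pairs k) (congruence_classes k E) \<le> 0 + ennreal \<epsilon>" by simp
  qed
  then show ?thesis by (simp add: E_def)
qed

section \<open>From null sets to lower bounds on the threshold\<close>

text \<open>Each such \<open>E\<close> excludes \<alpha> from the set whose infimum is the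
  threshold. Nonemptiness of that set has to be shown as well, because the real \<open>Inf\<close>
  of the empty set carries no information; the dimension bound for bounded sets supplies the element
  \<open>d + 1\<close>.\<close>

lemma threshold_geI:
  assumes "\<And>\<alpha>. \<alpha> < b \<Longrightarrow> \<exists>E :: (real ^ 'n) set. compact E \<and> ereal \<alpha> < hausdorff_dim E \<and>
             emeasure (lebesgue_pairs k) (congruence_classes k E) = 0"
  shows "b \<le> threshold k TYPE('n::finite)"
  unfolding threshold_def
proof (rule cInf_greatest)
  have "hausdorff_dim E \<le> ereal (real CARD('n) + 1)" if "compact E" for E :: "(real ^ 'n) set"
    using that by (intro hausdorff_dim_le_bounded compact_imp_bounded)
  then have "real CARD('n) + 1 \<in> {\<alpha>. \<forall>E :: (real ^ 'n) set. compact E \<and> ereal \<alpha> < hausdorff_dim E \<longrightarrow>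
      0 < emeasure (lebesgue_pairs k) (congruence_classes k E)}"
    by (auto simp flip: not_le)
  then show "{\<alpha>. \<forall>E :: (real ^ 'n) set. compact E \<and> ereal \<alpha> < hausdorff_dim E \<longrightarrow>
      0 < emeasure (lebesgue_pairs k) (congruence_classes k E)} \<noteq> {}"
    by (rule ex_in_conv[THEN iffD1, OF exI])
next
  fix \<alpha> assume \<alpha>: "\<alpha> \<in> {\<alpha>. \<forall>E :: (real ^ 'n) set. compact E \<and> ereal \<alpha> < hausdorff_dim E \<longrightarrow>
      0 < emeasure (lebesgue_pairs k) (congruence_classes k E)}"
  show "b \<le> \<alpha>"
  proof (rule ccontr)
    assume "\<not> b \<le> \<alpha>"
    then obtain E :: "(real ^ 'n) set" where "compact E" "ereal \<alpha> < hausdorff_dim E"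
      "emeasure (lebesgue_pairs k) (congruence_classes k E) = 0"
      using assms[of \<alpha>] by auto
    then show False using \<alpha> by force
  qed
qed

text \<open>For every \<open>t < 1 / \<mu>\<close> the product of \<open>d\<close> copies of the
  Cantor set has dimension at least \<open>d * t\<close> and null congruence classes, and
  \<open>d * t\<close> comes arbitrarily close to \<open>d / \<mu>\<close>.\<close>

lemma threshold_ge_if_lattice_count:
  assumes k: "1 \<le> k" and A: "0 \<le> A" and \<mu>: "1 \<le> \<mu>"
    and count: "\<And>q. 0 < q \<Longrightarrow> finite (lattice_classes k TYPE('n::finite) q) \<and>
       real (card (lattice_classes k TYPE('n) q)) \<le> A * (real q powr \<mu>) ^ card (index_pairs k)"
  shows "real CARD('n) / \<mu> \<le> threshold k TYPE('n)"
proof (rule threshold_geI)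
  fix \<alpha> assume \<alpha>: "\<alpha> < real CARD('n) / \<mu>"
  define d where "d = real CARD('n)"
  have d: "0 < d" by (simp add: d_def)
  \<comment> \<open>The maximum with 0 keeps \<open>t\<close> positive even when \<alpha> is
    negative.\<close>
  have "max 0 (\<alpha> / d) < 1 / \<mu>" using \<alpha> \<mu> d unfolding d_def by (simp add: field_simps)
  then obtain t where t: "0 < t" "\<alpha> / d < t" "t < 1 / \<mu>"
    using dense by (metis max_less_iff_conj)
  then have "t * \<mu> < 1" using \<mu> by (simp add: field_simps)
  obtain K :: "real set" and \<phi> C where K: "compact K" "K \<subseteq> {0..1}" and C: "0 < C"
    and \<phi>: "\<And>y. y \<in> {0..<1} \<Longrightarrow> \<phi> y \<in> K"
    and holder: "\<And>y z. y \<in> {0..<1} \<Longrightarrow> z \<in> {0..<1} \<Longrightarrow> \<bar>y - z\<bar> \<le> C * \<bar>\<phi> y - \<phi> z\<bar> powr t"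
    and near: "\<And>\<epsilon>. 0 < \<epsilon> \<Longrightarrow> \<exists>q::nat. \<exists>\<delta>>0. 0 < q \<and> real q powr \<mu> * \<delta> \<le> \<epsilon> \<and>
       (\<forall>x\<in>K. \<exists>z::int. \<bar>x - z / q\<bar> \<le> \<delta>)"
    by (rule cantor_set_near_lattices[OF t(1) \<mu> \<open>t * \<mu> < 1\<close>]) (rule that; assumption)
  define E where "E = {x :: real ^ 'n. \<forall>i. x $ i \<in> K}"
  have "compact E" unfolding E_def using K(1) by (rule compact_vec_box)
  moreover have "ereal (real (card (UNIV :: 'n set)) * t) \<le> hausdorff_dim E"
  proof (rule hausdorff_dim_ge)
    let ?p = "\<lambda>y :: 'n \<Rightarrow> real. (\<chi> i. \<phi> (y i)) :: real ^ 'n"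
    show "?p y \<in> E" if "y \<in> UNIV \<rightarrow>\<^sub>E {0..<1}" for y
      using that \<phi> by (auto simp: E_def PiE_iff)
    show "\<bar>y i - z i\<bar> \<le> C * dist (?p y) (?p z) powr t"
      if "y \<in> UNIV \<rightarrow>\<^sub>E {0..<1}" "z \<in> UNIV \<rightarrow>\<^sub>E {0..<1}" for y z i
    proof -
      have "\<bar>y i - z i\<bar> \<le> C * \<bar>\<phi> (y i) - \<phi> (z i)\<bar> powr t"
        using that by (intro holder) (auto simp: PiE_iff)
      also have "\<dots> \<le> C * dist (?p y) (?p z) powr t"
        using C t component_le_norm_cart[of "?p y - ?p z" i]
        by (intro mult_left_mono powr_mono2) (auto simp: dist_norm)
      finally show ?thesis .
    qed
  qed (use t C in auto)
  then have "ereal \<alpha> < hausdorff_dim E"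
    using t d unfolding d_def by (intro less_le_trans[OF _ \<open>ereal _ \<le> _\<close>]) (simp add: field_simps)
  moreover have "emeasure (lebesgue_pairs k) (congruence_classes k E) = 0"
    unfolding E_def using \<mu>
    by (intro emeasure_congruence_classes_near_lattices_eq_0[OF k A K(2) near _ count]) auto
  ultimately show "\<exists>E :: (real ^ 'n) set. compact E \<and> ereal \<alpha> < hausdorff_dim E \<and>
      emeasure (lebesgue_pairs k) (congruence_classes k E) = 0"
    by (intro exI[of _ E] conjI)
qed

section \<open>Counting distance vectors of lattice simplices\<close>

text \<open>Serves both counts: the distance is encoded by one natural number, and it depends only
  on coordinate differences, hence is invariant under translation.\<close>

lemma norm_lattice_point_diff:
  assumes "0 < q"
  shows "norm (lattice_point q z - lattice_point q w :: real ^ 'n) =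
           sqrt (real (nat (\<Sum>l\<in>UNIV. (z l - w l)\<^sup>2))) / real q"
proof -
  have "norm (lattice_point q z - lattice_point q w :: real ^ 'n) =
      sqrt (\<Sum>l\<in>UNIV. (real_of_int (z l - w l) / real q)\<^sup>2)"
    by (simp add: norm_vec_def L2_set_def lattice_point_def diff_divide_distrib)
  also have "(\<Sum>l\<in>UNIV. (real_of_int (z l - w l) / real q)\<^sup>2) =
      real_of_int (\<Sum>l\<in>UNIV. (z l - w l)\<^sup>2) / (real q)\<^sup>2"
    by (simp add: power_divide sum_divide_distrib)
  also have "sqrt \<dots> = sqrt (real_of_int (\<Sum>l\<in>UNIV. (z l - w l)\<^sup>2)) / real q"
    by (simp add: real_sqrt_divide)
  also have "real_of_int (\<Sum>l\<in>UNIV. (z l - w l)\<^sup>2) = real (nat (\<Sum>l\<in>UNIV. (z l - w l)\<^sup>2))"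
    by (simp add: sum_nonneg)
  finally show ?thesis .
qed

text \<open>Counts each of the distances separately: \<open>q\<close> times a distance is the square root of an
  integer of size \<open>O(q\<^sup>2)\<close>.\<close>

lemma card_lattice_classes_le_distances:
  assumes q: "0 < q"
  shows "finite (lattice_classes k TYPE('n::finite) q) \<and>
    real (card (lattice_classes k TYPE('n) q)) \<le>
      (17 * real CARD('n)) ^ card (index_pairs k) * (real q powr 2) ^ card (index_pairs k)"
proof -
  define d where "d = CARD('n)"
  \<comment> \<open>Coordinates of size at most \<open>2 * q\<close> differ by at most
    \<open>4 * q\<close>, so the sum of \<open>d\<close> squares is at most
    \<open>16 * d * q\<^sup>2\<close>. The value 0 adds one more element, absorbed by the factor
    17.\<close>
  define S where "S = (\<lambda>w. sqrt (real w) / real q) ` {..16 * d * q\<^sup>2}"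
  define F where "F = index_pairs k \<rightarrow>\<^sub>E S"
  have "card S \<le> 16 * d * q\<^sup>2 + 1"
    unfolding S_def using card_image_le[of "{..16 * d * q\<^sup>2}"] by simp
  also have "\<dots> \<le> 17 * d * q\<^sup>2" using q by (simp add: d_def Suc_leI)
  finally have "real (card S) \<le> real (17 * d * q\<^sup>2)" by (simp only: of_nat_le_iff)
  then have S: "finite S" "real (card S) \<le> 17 * real d * (real q)\<^sup>2"
    by (simp_all add: S_def)
  have "lattice_classes k TYPE('n) q \<subseteq> F"
    unfolding lattice_classes_def F_def
  proof (clarify, rule PiE_I)
    fix z :: "nat \<Rightarrow> 'n \<Rightarrow> int" and p
    assume z: "\<forall>i\<in>{1..k+1}. \<forall>l. \<bar>z i l\<bar> \<le> 2 * int q" and p: "p \<in> index_pairs k"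
    obtain i j where ij: "p = (i, j)" by fastforce
    then have "i \<in> {1..k+1}" "j \<in> {1..k+1}" using p by (auto simp: index_pairs_def)
    then have *: "\<bar>z i l\<bar> \<le> 2 * int q" "\<bar>z j l\<bar> \<le> 2 * int q" for l
      using z by blast+
    have "(z i l - z j l)\<^sup>2 \<le> (4 * int q)\<^sup>2" for l
    proof -
      have "\<bar>z i l - z j l\<bar> \<le> 4 * int q" using *[of l] by linarith
      then have "\<bar>z i l - z j l\<bar>\<^sup>2 \<le> (4 * int q)\<^sup>2" by (rule power_mono) simp
      then show ?thesis by simp
    qed
    then have "(\<Sum>l\<in>UNIV. (z i l - z j l)\<^sup>2) \<le> (\<Sum>l\<in>(UNIV :: 'n set). (4 * int q)\<^sup>2)"
      by (intro sum_mono) auto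
    then have "nat (\<Sum>l\<in>UNIV. (z i l - z j l)\<^sup>2) \<le> 16 * d * q\<^sup>2"
      by (simp add: d_def nat_le_iff power_mult_distrib)
    then show "(\<lambda>(i, j)\<in>index_pairs k. norm (lattice_point q (z i) - lattice_point q (z j))) p \<in> S"
      using p q by (auto simp: ij S_def norm_lattice_point_diff)
  qed auto
  moreover have "finite F" unfolding F_def using S finite_index_pairs by (intro finite_PiE) auto
  moreover have "real (card F) \<le> (17 * real d * (real q)\<^sup>2) ^ card (index_pairs k)"
    unfolding F_def using S finite_index_pairs[of k] by (simp add: card_PiE power_mono)
  ultimately show ?thesis
    using finite_subset card_mono[of F "lattice_classes k TYPE('n) q"] q
    by (auto simp: d_def power_mult_distrib)
qed

text \<open>Counts simplices with a vertex at the origin, which up to translation is no restriction.\<close>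

lemma card_lattice_classes_le_simplices:
  assumes q: "0 < q"
  shows "finite (lattice_classes k TYPE('n::finite) q) \<and>
    real (card (lattice_classes k TYPE('n) q)) \<le> 9 ^ (CARD('n) * k) * real q ^ (CARD('n) * k)"
proof -
  define V where "V = {2..k+1} \<rightarrow>\<^sub>E ((UNIV :: 'n set) \<rightarrow>\<^sub>E {- 4 * int q..4 * int q})"
  \<comment> \<open>Vertex 1 is placed at the origin and only the vertices
    \<open>2, ..., k + 1\<close> are counted. Their coordinates are differences, which explains the
    range \<open>4 * q\<close> in \<open>V\<close>.\<close>
  define pin where "pin v i = (if i = 1 then \<lambda>_. 0 else v i)" for v :: "nat \<Rightarrow> 'n \<Rightarrow> int" and i :: nat
  define f where "f v = (\<lambda>(i, j)\<in>index_pairs k.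
      norm (lattice_point q (pin v i) - lattice_point q (pin v j)))" for v
  have "lattice_classes k TYPE('n) q \<subseteq> f ` V"
    unfolding lattice_classes_def
  proof clarify
    fix z :: "nat \<Rightarrow> 'n \<Rightarrow> int"
    assume z: "\<forall>i\<in>{1..k+1}. \<forall>l. \<bar>z i l\<bar> \<le> 2 * int q"
    define v where "v = (\<lambda>i\<in>{2..k+1}. \<lambda>l. z i l - z 1 l)"
    have "\<bar>z i l - z 1 l\<bar> \<le> 4 * int q" if "i \<in> {2..k+1}" for i l
    proof -
      have "\<bar>z i l\<bar> \<le> 2 * int q" "\<bar>z 1 l\<bar> \<le> 2 * int q" using z that by auto
      then show ?thesis by linarith
    qed
    then have "v \<in> V" unfolding V_def v_def by (auto simp: PiE_iff abs_le_iff algebra_simps)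
    moreover have "(\<lambda>(i, j)\<in>index_pairs k. norm (lattice_point q (z i) - lattice_point q (z j))) = f v"
      unfolding f_def
    proof (rule restrict_ext, clarify)
      fix i j assume ij: "(i, j) \<in> index_pairs k"
      have "pin v a = (\<lambda>l. z a l - z 1 l)" if "a \<in> {1..k+1}" for a
        using that by (auto simp: pin_def v_def)
      then have "pin v i = (\<lambda>l. z i l - z 1 l)" "pin v j = (\<lambda>l. z j l - z 1 l)"
        using ij by (auto simp: index_pairs_def)
      then show "norm (lattice_point q (z i) - lattice_point q (z j)) =
          norm (lattice_point q (pin v i) - lattice_point q (pin v j))"
        using q by (simp add: norm_lattice_point_diff)
    qed
    ultimately show "(\<lambda>(i, j)\<in>index_pairs k. norm (lattice_point q (z i) - lattice_point q (z j))) \<in> f ` V"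
      by blast
  qed
  moreover have "finite V" unfolding V_def by (intro finite_PiE) auto
  moreover have "real (card V) \<le> 9 ^ (CARD('n) * k) * real q ^ (CARD('n) * k)"
  proof -
    have "nat (4 * int q - - 4 * int q + 1) = 8 * q + 1" by linarith
    then have "card V = (8 * q + 1) ^ (CARD('n) * k)"
      unfolding V_def by (simp add: card_PiE power_mult)
    also have "\<dots> \<le> (9 * q) ^ (CARD('n) * k)" using q by (intro power_mono) auto
    finally have "real (card V) \<le> real ((9 * q) ^ (CARD('n) * k))" by (simp only: of_nat_le_iff)
    then show ?thesis by (simp add: power_mult_distrib)
  qed
  ultimately show ?thesis
    using finite_subset[of _ "f ` V"] card_mono[of "f ` V" "lattice_classes k TYPE('n) q"]
      card_image_le[of V f] by (auto intro: order_trans[rotated])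
qed

section \<open>Sets without nondegenerate simplices\<close>

text \<open>The set \<open>E\<close> is a unit cube in the span of \<open>k - 1\<close> coordinate
  axes. It has dimension at least \<open>k - 1\<close>, while the \<open>k\<close> difference
  vectors of a nondegenerate tuple cannot be independent in that span.\<close>

lemma threshold_ge_degenerate:
  assumes k: "1 \<le> k" "k \<le> CARD('n::finite)"
  shows "real k - 1 \<le> threshold k TYPE('n)"
proof (rule threshold_geI)
  fix \<alpha> assume \<alpha>: "\<alpha> < real k - 1"
  obtain M :: "'n set" where M: "card M = k - 1"
    using k obtain_subset_with_card_n[of "k - 1" "UNIV :: 'n set"]
    by (metis diff_le_self le_trans)
  define E where "E = {x :: real ^ 'n. \<forall>i. x $ i \<in> (if i \<in> M then {0..1} else {0})}"
  have "compact E" unfolding E_def by (rule compact_vec_box) simp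
  moreover have "ereal (real (card M) * 1) \<le> hausdorff_dim E"
  proof (rule hausdorff_dim_ge)
    let ?p = "\<lambda>y :: 'n \<Rightarrow> real. (\<chi> i. if i \<in> M then y i else 0) :: real ^ 'n"
    show "?p y \<in> E" if "y \<in> M \<rightarrow>\<^sub>E {0..<1}" for y
      using that by (force simp: E_def PiE_iff)
    show "\<bar>y i - z i\<bar> \<le> 1 * dist (?p y) (?p z) powr 1" if "i \<in> M" for y z i
      using component_le_norm_cart[of "?p y - ?p z" i] that by (simp add: dist_norm)
  qed auto
  then have "ereal \<alpha> < hausdorff_dim E"
    using \<alpha> k M by (intro less_le_trans[OF _ \<open>ereal _ \<le> _\<close>]) (simp add: of_nat_diff)
  moreover have "congruence_classes k E = {}"
  proof -
    have False if x: "\<forall>i\<in>{1..k+1}. x i \<in> E" and "nondegenerate k x" for x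
    proof -
      let ?D = "(\<lambda>i. x i - x 1) ` {2..k+1}"
      let ?B = "(\<lambda>i. axis i (1::real)) ` M"
      have "?D \<subseteq> span ?B"
      proof clarify
        fix i assume "i \<in> {2..k+1}"
        then have "x i \<in> E" "x 1 \<in> E" using x by auto
        then have "(x i - x 1) $ l = 0" if "l \<notin> M" for l
          using that by (auto simp: E_def dest!: spec[of _ l])
        then have "x i - x 1 = (\<Sum>l\<in>M. ((x i - x 1) $ l) *\<^sub>R axis l 1)"
          by (auto simp: vec_eq_iff axis_def if_distrib sum.delta cong: if_cong)
        also have "\<dots> \<in> span ?B"
          by (intro span_sum span_scale span_base) auto
        finally show "x i - x 1 \<in> span ?B" .
      qed
      then have "card ?D \<le> card ?B"
        using \<open>nondegenerate k x\<close> by (intro independent_span_bound[THEN conjunct2])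
          (auto simp: nondegenerate_def)
      also have "card ?B \<le> k - 1" using card_image_le[of M "\<lambda>i. axis i (1::real)"] M by simp
      also have "card ?D = k"
        using \<open>nondegenerate k x\<close> by (simp add: nondegenerate_def card_image)
      finally show False using k by simp
    qed
    then show ?thesis unfolding congruence_classes_def by blast
  qed
  ultimately show "\<exists>E :: (real ^ 'n) set. compact E \<and> ereal \<alpha> < hausdorff_dim E \<and>
      emeasure (lebesgue_pairs k) (congruence_classes k E) = 0"
    by (intro exI[of _ E]) simp
qed

theorem theorem1p8:
  fixes k :: nat
  shows "(2 \<le> CARD('n::finite) \<and> 1 \<le> k \<and> k \<le> CARD('n) \<longrightarrow>
            threshold k TYPE('n) \<ge> max (real k - 1) (real CARD('n) / 2)) \<and>
         threshold 2 TYPE(2) \<ge> 3 / 2"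
proof (intro conjI impI)
  assume *: "2 \<le> CARD('n) \<and> 1 \<le> k \<and> k \<le> CARD('n)"
  have "real k - 1 \<le> threshold k TYPE('n)"
    using * by (intro threshold_ge_degenerate) auto
  moreover have "real CARD('n) / 2 \<le> threshold k TYPE('n)"
    by (rule threshold_ge_if_lattice_count[OF _ _ _ card_lattice_classes_le_distances])
      (use * in auto)
  ultimately show "threshold k TYPE('n) \<ge> max (real k - 1) (real CARD('n) / 2)"
    by simp
next
  have "index_pairs 2 = {(1, 2), (1, 3), (2, 3)}"
    by (auto simp: index_pairs_def)
  then have pairs: "card (index_pairs 2) = 3" by simp
  \<comment> \<open>The exponent \<open>4 / 3\<close> spreads the count \<open>O(q ^ 4)\<close> of
    triangles with a vertex at the origin over the 3 distances.\<close>
  have "real CARD(2) / (4 / 3) \<le> threshold 2 TYPE(2)"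
  proof (rule threshold_ge_if_lattice_count)
    fix q :: nat assume q: "0 < q"
    have "(real q powr (4 / 3)) ^ 3 = (real q powr (4 / 3)) powr real 3"
      using q by (intro powr_realpow[symmetric]) simp
    also have "\<dots> = real q powr real 4" by (simp add: powr_powr)
    also have "\<dots> = real q ^ 4" using q by (intro powr_realpow) simp
    finally have "(real q powr (4 / 3)) ^ card (index_pairs 2) = real q ^ (CARD(2) * 2)"
      by (simp add: pairs)
    then show "finite (lattice_classes 2 TYPE(2) q) \<and> real (card (lattice_classes 2 TYPE(2) q)) \<le>
        9 ^ (CARD(2) * 2) * (real q powr (4 / 3)) ^ card (index_pairs 2)"
      using card_lattice_classes_le_simplices[OF q, of 2, where 'n = 2] by simp
  qed auto
  then show "threshold 2 TYPE(2) \<ge> 3 / 2" by simp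
qed

end
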